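(* Let $n$ and $m$ be non-negative integers with $m>0$, and let $r,\beta$ be real or complex numbers with $\beta\neq 0$. Then $$\sum_{j=0}^{m-1}(r+\beta j)^{n}=\sum_{k=0}^{n}\frac{\beta^{k-1}}{k+1}W_{\beta,r}(n,k)\,(m)_{k+1}.$$
   Context: The falling factorial is $(m)_0=1$, $(m)_{k}=m(m-1)\cdots(m-k+1)$ for $k\ge 1$. The $r$-Whitney numbers of the second kind $W_{\beta,r}(n,k)$ are defined by the formal power series identity $$\left(\frac{e^{\beta t}-1}{\beta}\right)^{k}e^{rt}=k!\sum_{n=0}^{\infty}W_{\beta,r}(n,k)\frac{t^{n}}{n!}.$$ An $n$-th power with $n=0$ is read as $1$.
   Formalization: The printed factor β^{k-1} is corrected to β^k: with the given definition of W the printed identity fails, e.g. for n=0, m=1, β=2 the left side is 1 and the right side is 1/2. *)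

theory Defs
  imports
    Complex_Main
    "HOL-Computational_Algebra.Formal_Power_Series"
begin

definition falling_factorial :: "complex \<Rightarrow> nat \<Rightarrow> complex" where
  "falling_factorial x k = (\<Prod>i<k. x - of_nat i)"

text \<open>
  The coefficients of the exponential generating function defining the $r$-Whitney numbers of
  the second kind, read off explicitly; \<open>r_Whitney2_egf\<close> below is the defining identity.
\<close>

definition r_Whitney2 :: "complex \<Rightarrow> complex \<Rightarrow> nat \<Rightarrow> nat \<Rightarrow> complex" where
  "r_Whitney2 \<beta> r n k =
     fact n / fact k * fps_nth (((fps_exp \<beta> - 1) / fps_const \<beta>) ^ k * fps_exp r) n"

lemma r_Whitney2_egf:
  "((fps_exp \<beta> - 1) / fps_const \<beta>) ^ k * fps_exp r =
     fps_const (fact k) * Abs_fps (\<lambda>n. r_Whitney2 \<beta> r n k / fact n)"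
  by (simp add: fps_eq_iff r_Whitney2_def)

end

theory Submission
  imports Defs
begin

text \<open>
  Expanding \<open>exp ((r + \<beta> j) t) = exp (r t) (1 + (exp (\<beta> t) - 1))\<^sup>j\<close> by the binomial theorem
  expresses \<open>(r + \<beta> j) ^ n\<close> through the binomial coefficients of \<open>j\<close>, which the hockey-stick
  identity sums over \<open>j\<close>. The resulting weight is \<open>\<beta> ^ k / (k + 1)\<close>; with the exponent \<open>k - 1\<close> of
  the informal statement the identity fails for \<open>n = 0\<close>, \<open>\<beta> \<noteq> 1\<close>.
\<close>

lemma falling_factorial_of_nat:
  "falling_factorial (of_nat m) k = fact k * of_nat (m choose k)"
  by (simp add: falling_factorial_def binomial_gbinomial gbinomial_prod_rev atLeast0LessThan)

text \<open>The series \<open>(fps_exp \<beta> - 1) / fps_const \<beta>\<close> has zero constant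
  term, so its \<open>k\<close>-th power has no terms below degree \<open>k\<close>.\<close>

lemma r_Whitney2_eq_0:
  assumes "n < k"
  shows "r_Whitney2 \<beta> r n k = 0"
proof -
  define g where "g = (fps_exp \<beta> - 1) / fps_const \<beta>"
  have "fps_nth g 0 = 0"
    by (cases "\<beta> = 0") (simp_all add: g_def fps_divide_unit fps_const_inverse)
  then have "fps_nth (g ^ k) i = 0" if "i \<le> n" for i
    using that assms by (intro startsby_zero_power_prefix[rule_format]) auto
  then show ?thesis
    by (simp add: r_Whitney2_def g_def fps_mult_nth)
qed

lemma power_eq_sum_r_Whitney2:
  assumes "\<beta> \<noteq> 0"
  shows "(r + \<beta> * of_nat j) ^ n =
    (\<Sum>k\<le>n. \<beta> ^ k * fact k * r_Whitney2 \<beta> r n k * of_nat (j choose k))"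
proof -
  define g where "g = (fps_exp \<beta> - 1) / fps_const \<beta>"
  have g: "fps_exp \<beta> = fps_const \<beta> * g + 1"
    using assms by (simp add: g_def fps_divide_unit fps_const_inverse flip: mult.assoc)
  have "fps_exp (r + \<beta> * of_nat j) = fps_exp \<beta> ^ j * fps_exp r"
    by (simp add: fps_exp_add_mult fps_exp_power_mult mult.commute)
  also have "\<dots> = (\<Sum>k\<le>j. fps_const (of_nat (j choose k) * \<beta> ^ k) * (g ^ k * fps_exp r))"
    unfolding g binomial_ring
    by (simp add: sum_distrib_right power_mult_distrib mult.assoc fps_of_nat
        flip: fps_const_power fps_const_mult)
  finally have "fps_nth (fps_exp (r + \<beta> * of_nat j)) n =
      (\<Sum>k\<le>j. of_nat (j choose k) * \<beta> ^ k * fps_nth (g ^ k * fps_exp r) n)"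
    by (simp add: fps_sum_nth)
  then have "(r + \<beta> * of_nat j) ^ n =
      (\<Sum>k\<le>j. fact n * (of_nat (j choose k) * \<beta> ^ k * fps_nth (g ^ k * fps_exp r) n))"
    by (simp add: field_simps flip: sum_distrib_left)
  also have "\<dots> = (\<Sum>k\<le>j. \<beta> ^ k * fact k * r_Whitney2 \<beta> r n k * of_nat (j choose k))"
    by (intro sum.cong) (simp_all add: r_Whitney2_def g_def)
  \<comment> \<open>\<open>n + j\<close> bounds both ranges: terms with \<open>k > j\<close> vanish
    through \<open>j choose k\<close>, those with \<open>k > n\<close> through the Whitney
    number.\<close>
  also have "\<dots> = (\<Sum>k\<le>n + j. \<beta> ^ k * fact k * r_Whitney2 \<beta> r n k * of_nat (j choose k))"
    by (intro sum.mono_neutral_left) auto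
  also have "\<dots> = (\<Sum>k\<le>n. \<beta> ^ k * fact k * r_Whitney2 \<beta> r n k * of_nat (j choose k))"
    by (intro sum.mono_neutral_right) (auto simp: r_Whitney2_eq_0)
  finally show ?thesis .
qed

theorem corollary9:
  fixes n m :: nat and r \<beta> :: complex
  assumes "m > 0" and "\<beta> \<noteq> 0"
  shows "(\<Sum>j = 0..m - 1. (r + \<beta> * of_nat j) ^ n) =
    (\<Sum>k = 0..n. \<beta> ^ k / of_nat (k + 1) * r_Whitney2 \<beta> r n k *
        falling_factorial (of_nat m) (k + 1))"
proof -
  \<comment> \<open>Positivity of \<open>m\<close> gives \<open>Suc (m - 1) = m\<close>.\<close>
  have hockey: "(\<Sum>j = 0..m - 1. j choose k) = m choose Suc k" for k
    using sum_choose_upper[of k "m - 1"] assms(1) by (simp add: atMost_atLeast0)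
  have "(\<Sum>j = 0..m - 1. (r + \<beta> * of_nat j) ^ n) =
      (\<Sum>k\<le>n. \<Sum>j = 0..m - 1. \<beta> ^ k * fact k * r_Whitney2 \<beta> r n k * of_nat (j choose k))"
    unfolding power_eq_sum_r_Whitney2[OF assms(2)] by (rule sum.swap)
  also have "\<dots> = (\<Sum>k\<le>n. \<beta> ^ k * fact k * r_Whitney2 \<beta> r n k * of_nat (m choose Suc k))"
    by (simp flip: sum_distrib_left of_nat_sum hockey)
  \<comment> \<open>The divisor \<open>k + 1\<close> is what remains of
    \<open>fact k / fact (k + 1)\<close>.\<close>
  also have "\<dots> = (\<Sum>k = 0..n. \<beta> ^ k / of_nat (k + 1) * r_Whitney2 \<beta> r n k *
      falling_factorial (of_nat m) (k + 1))"
    unfolding falling_factorial_of_nat atMost_atLeast0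
    by (intro sum.cong) (simp_all add: divide_simps del: of_nat_Suc)
  finally show ?thesis .
qed

end
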